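(* Let $A$ be a finite nonempty set of men (occupied cells) on a board that is a finite set of cells in $\mathbb{Z}^2$, with no other men on the board, and fix one of the 4-move, 6-move or 8-move rules described in the context. Let $\mathbf a_{\min}\in A$ be a man of minimum centroid and $\mathbf a_{\max}\in A$ a man of maximum centroid. Then a single move (a step or a chain of jumps by one man) changes the army centroid $c(A)$ by an amount in the interval $[-\delta,\delta]$, where $$\delta=c(\mathbf a_{\max})-c(\mathbf a_{\min})+\ell,$$ with $\ell=1$ for 4-move and 6-move rules and $\ell=2$ for 8-move rules.
   Context: Cells are identified with Cartesian coordinates $(x,y)$. Move rules: a set $D$ of allowed directions is fixed: 4-move $D=\{(\pm1,0),(0,\pm1)\}$; 6-move $D=\{(\pm1,0),(0,\pm1),\pm(1,1)\}$; 8-move $D=\{(a,b):a,b\in\{-1,0,1\},(a,b)\ne(0,0)\}$. A move moves a single man either by a step from $p$ to an empty cell $p+v$ ($v\in D$), or by a chain of one or more jumps, each jump going from $p$ over an occupied cell $p+v$ ($v\in D$) into an empty cell $p+2v$ (jumped men are not removed). The centroid of a man $\mathbf a=(a_x,a_y)$ is $c(\mathbf a)=a_x-a_y$, and the centroid of an army is $c(A)=\sum_{\mathbf a\in A}c(\mathbf a)$. *)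

theory Defs
  imports Main "HOL-Library.Product_Plus"
begin

type_synonym cell = "int \<times> int"

datatype move_rule = Move4 | Move6 | Move8

fun dirs :: "move_rule \<Rightarrow> cell set" where
  "dirs Move4 = {(1, 0), (-1, 0), (0, 1), (0, -1)}"
| "dirs Move6 = {(1, 0), (-1, 0), (0, 1), (0, -1), (1, 1), (-1, -1)}"
| "dirs Move8 = {(a, b). a \<in> {-1, 0, 1} \<and> b \<in> {-1, 0, 1} \<and> (a, b) \<noteq> (0, 0)}"

text \<open>A configuration is the set \<open>A\<close> of occupied cells of a board \<open>B\<close>; the empty cells are
  those of \<open>B - A\<close>.\<close>

definition relocate :: "cell set \<Rightarrow> cell \<Rightarrow> cell \<Rightarrow> cell set" where
  "relocate A p q = insert q (A - {p})"

definition is_step :: "move_rule \<Rightarrow> cell set \<Rightarrow> cell set \<Rightarrow> cell \<Rightarrow> cell \<Rightarrow> bool" where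
  "is_step R B A p q \<longleftrightarrow> p \<in> A \<and> q \<in> B - A \<and> (\<exists>v\<in>dirs R. q = p + v)"

definition is_jump :: "move_rule \<Rightarrow> cell set \<Rightarrow> cell set \<Rightarrow> cell \<Rightarrow> cell \<Rightarrow> bool" where
  "is_jump R B A p q \<longleftrightarrow>
     p \<in> A \<and> q \<in> B - A \<and> (\<exists>v\<in>dirs R. p + v \<in> A \<and> q = p + v + v)"

text \<open>\<open>jump_chain R B A p A' q\<close>: from configuration \<open>A\<close>, the man at \<open>p\<close> makes one or more jumps,
  ending at \<open>q\<close> with configuration \<open>A'\<close>. The configuration is updated after every jump, so the
  cells the man has left, in particular \<open>p\<close>, count as empty for its later jumps.\<close>

inductive jump_chain ::
    "move_rule \<Rightarrow> cell set \<Rightarrow> cell set \<Rightarrow> cell \<Rightarrow> cell set \<Rightarrow> cell \<Rightarrow> bool"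
  for R :: move_rule and B :: "cell set" and A :: "cell set" and p :: cell where
  first: "is_jump R B A p q \<Longrightarrow> jump_chain R B A p (relocate A p q) q"
| again: "jump_chain R B A p A' q \<Longrightarrow> is_jump R B A' q r \<Longrightarrow>
            jump_chain R B A p (relocate A' q r) r"

definition single_move :: "move_rule \<Rightarrow> cell set \<Rightarrow> cell set \<Rightarrow> cell set \<Rightarrow> bool" where
  "single_move R B A A' \<longleftrightarrow>
     (\<exists>p q. is_step R B A p q \<and> A' = relocate A p q) \<or> (\<exists>p q. jump_chain R B A p A' q)"

definition centroid :: "cell \<Rightarrow> int" where
  "centroid a = fst a - snd a"

definition army_centroid :: "cell set \<Rightarrow> int" where
  "army_centroid A = (\<Sum>a\<in>A. centroid a)"

fun ell :: "move_rule \<Rightarrow> int" where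
  "ell Move4 = 1"
| "ell Move6 = 1"
| "ell Move8 = 2"

end

theory Submission
  imports Defs
begin

text \<open>A move takes one man from a cell \<open>p\<close> to a cell \<open>q\<close>, and \<open>q\<close> is adjacent to a cell of the
  original army: to \<open>p\<close> for a step, and to the last man jumped over for a chain. That man differs
  from the moving one, so it stands where it stood before the move. Hence the centroid of \<open>q\<close>
  leaves the range of the centroids of the army by at most \<open>\<ell>\<close>.\<close>

lemma centroid_add: "centroid (a + b) = centroid a + centroid b"
  by (simp add: centroid_def)

text \<open>The 6-move diagonals have centroid 0; only the 8-move directions \<open>(1, -1)\<close>
  and \<open>(-1, 1)\<close> reach absolute value 2.\<close>

lemma abs_centroid_dirs_le: "v \<in> dirs R \<Longrightarrow> \<bar>centroid v\<bar> \<le> ell R"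
  by (cases R) (auto simp: centroid_def)

lemma zero_notin_dirs: "0 \<notin> dirs R"
  by (cases R) (auto simp: zero_prod_def)

lemma army_centroid_relocate:
  assumes "finite A" "p \<in> A" "q \<notin> A - {p}"
  shows "army_centroid (relocate A p q) = army_centroid A - centroid p + centroid q"
  using assms by (simp add: army_centroid_def relocate_def sum_diff1)

text \<open>By induction all men but the mover stay put. Freeness of \<open>q\<close> is stated for
  \<open>A - {p}\<close> because a chain may return to \<open>p\<close>.\<close>

lemma jump_chain_relocate:
  assumes "jump_chain R B A p A' q"
  shows "p \<in> A \<and> A' = relocate A p q \<and> q \<notin> A - {p} \<and> (\<exists>a\<in>A. \<exists>v\<in>dirs R. q = a + v)"
  using assms
proof induction
  case (first q)
  then show ?case by (auto simp: is_jump_def)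
next
  case (again A' q r)
  then obtain v where v: "v \<in> dirs R" "q + v \<in> A'" "r = q + v + v" "r \<notin> A'"
    by (auto simp: is_jump_def)
  have A': "A' = insert q (A - {p})" and q: "q \<notin> A - {p}" and p: "p \<in> A"
    using again.IH by (auto simp: relocate_def)
  \<comment> \<open>The mover cannot jump over itself, so the man at \<open>q + v\<close> belongs to
    \<open>A - {p}\<close>.\<close>
  have "q + v \<noteq> q"
    using v(1) zero_notin_dirs by (metis add_cancel_left_right)
  then have "q + v \<in> A"
    using v(2) A' by auto
  moreover have "relocate A' q r = relocate A p r"
    using A' q by (auto simp: relocate_def)
  moreover have "r \<notin> A - {p}"
    using v(4) A' by auto
  ultimately show ?case
    using p v(1,3) by blast
qed

lemma single_move_relocate:
  assumes "single_move R B A A'"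
  obtains p q a v where "p \<in> A" "A' = relocate A p q" "q \<notin> A - {p}"
    "a \<in> A" "v \<in> dirs R" "q = a + v"
proof -
  from assms consider (step) p q where "is_step R B A p q" "A' = relocate A p q"
    | (chain) p q where "jump_chain R B A p A' q"
    by (auto simp: single_move_def)
  then show thesis
  proof cases
    case step
    then show thesis
      unfolding is_step_def using that by blast
  next
    case chain
    from jump_chain_relocate[OF this] show thesis
      using that by blast
  qed
qed

theorem theorem2:
  fixes R :: move_rule and board A A' :: "cell set" and amin amax :: cell
  assumes "finite board" and "A \<subseteq> board" and "finite A" and "A \<noteq> {}"
    and "is_arg_min centroid (\<lambda>a. a \<in> A) amin"
    and "is_arg_max centroid (\<lambda>a. a \<in> A) amax"
    and "single_move R board A A'"
  shows "let \<delta> = centroid amax - centroid amin + ell R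
         in army_centroid A' - army_centroid A \<in> {- \<delta> .. \<delta>}"
proof -
  from assms(7) obtain p q a v where move: "p \<in> A" "A' = relocate A p q" "q \<notin> A - {p}"
    and a: "a \<in> A" and v: "v \<in> dirs R" and q: "q = a + v"
    by (rule single_move_relocate)
  have bounds: "centroid amin \<le> centroid b \<and> centroid b \<le> centroid amax" if "b \<in> A" for b
    using assms(5,6) that unfolding is_arg_min_linorder is_arg_max_linorder by blast
  have "army_centroid A' - army_centroid A = centroid a + centroid v - centroid p"
    using army_centroid_relocate[OF assms(3) move(1,3)] move(2) q by (simp add: centroid_add)
  \<comment> \<open>Both \<open>a\<close> and \<open>p\<close> lie in \<open>A\<close>, so
    \<open>centroid a - centroid p\<close> is bounded by the spread of \<open>A\<close>;
    \<open>v\<close> adds at most \<open>ell R\<close>.\<close>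
  then show ?thesis
    using bounds[OF a] bounds[OF move(1)] abs_centroid_dirs_le[OF v] by (auto simp: Let_def)
qed

end
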